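(* Let $D_L\subset\mathbb{R}^n$ be a compact star-shaped Lyapunov domain containing a hyperbolic equilibrium ${\bf x}^\ast$ of $\frac{d}{dt}{\bf x}=f({\bf x})$, associated with a Lyapunov function $L({\bf x})=({\bf x}-{\bf x}^\ast)^TY({\bf x}-{\bf x}^\ast)$, $Y$ real symmetric, and such that ${\bf x}^\ast$ is the unique equilibrium in $D_L$. Let $$B_s := D_L\cap L^{-1}([0,\infty)),\qquad b_s := D_L\cap L^{-1}(0).$$ Assume that the boundary of $B_s$ consists of $b_s$ and a collection of hypersurfaces $\{S_i\}$ which are immediate entrances in the sense that, for any ${\bf x}\in S_i$, there is a positive number $\epsilon_{\bf x}>0$ such that $$\varphi((0,\epsilon_{\bf x}),{\bf x})\subset \mathrm{int}(D_L\cap L^{-1}(0,\infty)),\qquad \varphi((-\epsilon_{\bf x},0),{\bf x})\cap \mathrm{int}(D_L\cap L^{-1}(0,\infty))=\emptyset.$$ Define the map $R:B_s\to b_s$ by $$R({\bf x}) := \varphi(\tau({\bf x}),{\bf x}),\qquad \tau({\bf x}) := \sup\{t\ge 0\mid \varphi([0,t],{\bf x})\subset B_s\},$$ with $R({\bf x}):=\lim_{t\to+\infty}\varphi(t,{\bf x})$ when $\tau({\bf x})=+\infty$. Then $R$ is continuous. Moreover, $b_s$ is a strong deformation retract of $B_s$.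
   Context: $f:\mathbb{R}^n\to\mathbb{R}^n$ is a smooth map and $\varphi:\mathbb{R}\times\mathbb{R}^n\to\mathbb{R}^n$ is the flow generated by $\frac{d}{dt}{\bf x}=f({\bf x})$. An equilibrium ${\bf x}^\ast$ is hyperbolic if all eigenvalues of $Df({\bf x}^\ast)$ have nonzero real part. $D_L$ is a Lyapunov domain for $L$ if $L$ is a Lyapunov function on $D_L$: (1) $\frac{d}{dt}L(\varphi(t,{\bf x}))|_{t=0}\le 0$ for every ${\bf x}\in D_L$; and (2) for ${\bf x}\in D_L$, $\frac{d}{dt}L(\varphi(t,{\bf x}))|_{t=0}=0$ implies that $\varphi(t,{\bf x})\equiv\bar{\bf x}\in D_L$ for an equilibrium $\bar{\bf x}$. (With ${\bf x}^\ast$ the unique equilibrium in $D_L$, this means $\frac{d}{dt}L(\varphi(t,{\bf x}))|_{t=0}<0$ on $D_L\setminus\{{\bf x}^\ast\}$.) A subset $A$ of a compact set $Z$ is a strong deformation retract of $Z$ if there is a continuous map $h:Z\times[0,1]\to Z$ such that $h({\bf x},t)={\bf x}$ for all ${\bf x}\in A$ and $t\in[0,1]$, $h({\bf x},1)\in A$ for all ${\bf x}\in Z$, and $h({\bf x},0)={\bf x}$ for all ${\bf x}\in Z$. *)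

theory Defs
  imports "HOL-Analysis.Analysis"
begin

fun times_differentiable :: "nat \<Rightarrow> ('a::real_normed_vector \<Rightarrow> 'b::real_normed_vector) \<Rightarrow> bool" where
  "times_differentiable 0 g \<longleftrightarrow> continuous_on UNIV g"
| "times_differentiable (Suc k) g \<longleftrightarrow>
     (\<forall>x. g differentiable (at x)) \<and>
     (\<forall>v. times_differentiable k (\<lambda>x. frechet_derivative g (at x) v))"

text \<open>In finite dimension this is \<open>C\<^sup>\<infinity>\<close>: all iterated directional derivatives exist and are
  continuous.\<close>

definition smooth_map :: "('a::euclidean_space \<Rightarrow> 'b::real_normed_vector) \<Rightarrow> bool" where
  "smooth_map g \<longleftrightarrow> (\<forall>k. times_differentiable k g)"

definition flow_generated_by ::
    "('a::real_normed_vector \<Rightarrow> 'a) \<Rightarrow> (real \<Rightarrow> 'a \<Rightarrow> 'a) \<Rightarrow> bool" where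
  "flow_generated_by f \<phi> \<longleftrightarrow>
     continuous_on UNIV (\<lambda>(t, x). \<phi> t x) \<and>
     (\<forall>x. \<phi> 0 x = x) \<and>
     (\<forall>s t x. \<phi> (s + t) x = \<phi> s (\<phi> t x)) \<and>
     (\<forall>t x. ((\<lambda>t. \<phi> t x) has_vector_derivative f (\<phi> t x)) (at t))"

definition equilibrium :: "('a::real_normed_vector \<Rightarrow> 'a) \<Rightarrow> 'a \<Rightarrow> bool" where
  "equilibrium f p \<longleftrightarrow> f p = 0"

definition matrix_eigenvalue :: "complex^'n^'n \<Rightarrow> complex \<Rightarrow> bool" where
  "matrix_eigenvalue A \<mu> \<longleftrightarrow> (\<exists>v. v \<noteq> 0 \<and> A *v v = \<mu> *s v)"

definition hyperbolic_equilibrium :: "(real^'n \<Rightarrow> real^'n) \<Rightarrow> real^'n \<Rightarrow> bool" where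
  "hyperbolic_equilibrium f p \<longleftrightarrow>
     equilibrium f p \<and>
     (\<forall>\<mu>. matrix_eigenvalue (map_matrix complex_of_real (jacobian f (at p))) \<mu> \<longrightarrow> Re \<mu> \<noteq> 0)"

definition Lyapunov_domain ::
    "('a::real_normed_vector \<Rightarrow> 'a) \<Rightarrow> (real \<Rightarrow> 'a \<Rightarrow> 'a) \<Rightarrow> ('a \<Rightarrow> real) \<Rightarrow> 'a set \<Rightarrow> bool" where
  "Lyapunov_domain f \<phi> L D \<longleftrightarrow>
     (\<forall>x\<in>D. \<exists>d. ((\<lambda>t. L (\<phi> t x)) has_real_derivative d) (at 0) \<and> d \<le> 0 \<and>
        (d = 0 \<longrightarrow> (\<exists>p\<in>D. equilibrium f p \<and> (\<forall>t. \<phi> t x = p))))"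

text \<open>Topological submanifold of codimension one, possibly with boundary (or corners). The set
  \<open>{y. a \<bullet> y = 0 \<and> 0 \<le> b \<bullet> y}\<close> is a hyperplane if \<open>b\<close> is a multiple of \<open>a\<close> (in particular if
  \<open>b = 0\<close>), and otherwise a closed half of one.\<close>

definition hypersurface :: "'a::euclidean_space set \<Rightarrow> bool" where
  "hypersurface S \<longleftrightarrow>
     (\<forall>x\<in>S. \<exists>U (V :: 'a set) a b. x \<in> U \<and> openin (top_of_set S) U \<and> a \<noteq> 0 \<and>
        openin (top_of_set {y. a \<bullet> y = 0 \<and> 0 \<le> b \<bullet> y}) V \<and> U homeomorphic V)"

definition immediate_entrance ::
    "(real \<Rightarrow> 'a::topological_space \<Rightarrow> 'a) \<Rightarrow> 'a set \<Rightarrow> 'a set \<Rightarrow> bool" where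
  "immediate_entrance \<phi> P S \<longleftrightarrow>
     (\<forall>x\<in>S. \<exists>\<epsilon>>0. (\<lambda>t. \<phi> t x) ` {0<..<\<epsilon>} \<subseteq> interior P \<and>
                   (\<lambda>t. \<phi> t x) ` {-\<epsilon><..<0} \<inter> interior P = {})"

definition exit_time :: "(real \<Rightarrow> 'a \<Rightarrow> 'a) \<Rightarrow> 'a set \<Rightarrow> 'a \<Rightarrow> ereal" where
  "exit_time \<phi> B x = Sup (ereal ` {t. 0 \<le> t \<and> (\<lambda>s. \<phi> s x) ` {0..t} \<subseteq> B})"

definition exit_map :: "(real \<Rightarrow> 'a::t2_space \<Rightarrow> 'a) \<Rightarrow> 'a set \<Rightarrow> 'a \<Rightarrow> 'a" where
  "exit_map \<phi> B x =
     (if exit_time \<phi> B x = \<infinity> then Lim at_top (\<lambda>t. \<phi> t x)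
      else \<phi> (real_of_ereal (exit_time \<phi> B x)) x)"

definition strong_deformation_retract :: "'a::topological_space set \<Rightarrow> 'a set \<Rightarrow> bool" where
  "strong_deformation_retract A Z \<longleftrightarrow>
     compact Z \<and> A \<subseteq> Z \<and>
     (\<exists>h :: 'a \<times> real \<Rightarrow> 'a.
        continuous_on (Z \<times> {0..1}) h \<and> h \<in> Z \<times> {0..1} \<rightarrow> Z \<and>
        (\<forall>x\<in>A. \<forall>t\<in>{0..1}. h (x, t) = x) \<and>
        (\<forall>x\<in>Z. h (x, 1) \<in> A) \<and>
        (\<forall>x\<in>Z. h (x, 0) = x))"

end

theory Submission
  imports Defs
begin

text \<open>A trajectory starting in \<open>B\<close> can leave \<open>B\<close> only through the zero set of \<open>L\<close>, since all other
  boundary points are immediate entrances. Away from \<open>p\<close> it crosses that zero set strictly, which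
  makes the exit time \<open>\<tau>\<close> continuous there; a trajectory that never leaves converges to \<open>p\<close>. Near \<open>p\<close>,
  where \<open>\<tau>\<close> is discontinuous, trajectories are confined until they exit: straying from \<open>p\<close> would
  use up more of \<open>L\<close> than is available. Hence the flow stopped at time \<open>min g \<tau>\<close> is jointly
  continuous in the starting point and in \<open>g \<in> [0, \<infinity>]\<close>, and the rescaling \<open>g = s / (1 - s)\<close> turns it
  into the deformation.\<close>

section \<open>Abstract setting and basic properties of the flow\<close>

text \<open>Here \<open>B\<close> plays the part of \<open>B\<^sub>s\<close> and \<open>p\<close>
  that of the equilibrium. The orbital derivative of \<open>L\<close> is given as a continuous
  function \<open>L'\<close> on the whole space, so that it can be bounded on compact sets. The
  assumption \<open>entering\<close> covers two kinds of points at once: interior points of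
  \<open>B\<close> and immediate entrances.\<close>

locale lyapunov_exit =
  fixes f :: "'a::euclidean_space \<Rightarrow> 'a"
    and \<phi> :: "real \<Rightarrow> 'a \<Rightarrow> 'a"
    and L L' :: "'a \<Rightarrow> real"
    and B :: "'a set"
    and p :: 'a
  assumes flow: "flow_generated_by f \<phi>"
    and continuous_f: "continuous_on UNIV f"
    and continuous_L: "continuous_on UNIV L"
    and continuous_L': "continuous_on UNIV L'"
    and deriv_L: "((\<lambda>t. L (\<phi> t x)) has_real_derivative L' (\<phi> t x)) (at t)"
    and compact_B: "compact B"
    and L_nonneg: "x \<in> B \<Longrightarrow> 0 \<le> L x"
    and p_in_B: "p \<in> B"
    and L_p: "L p = 0"
    and flow_p: "\<phi> t p = p"
    and L'_neg: "x \<in> B \<Longrightarrow> x \<noteq> p \<Longrightarrow> L' x < 0"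
    and entering: "x \<in> B \<Longrightarrow> 0 < L x \<Longrightarrow> \<exists>\<epsilon>>0. \<forall>t\<in>{0<..<\<epsilon>}. \<phi> t x \<in> B"
begin

abbreviation \<tau> :: "'a \<Rightarrow> ereal" where
  "\<tau> \<equiv> exit_time \<phi> B"

definition remains :: "'a \<Rightarrow> real \<Rightarrow> bool" where
  "remains x t \<longleftrightarrow> 0 \<le> t \<and> (\<forall>s\<in>{0..t}. \<phi> s x \<in> B)"

lemma flow_0 [simp]: "\<phi> 0 x = x"
  using flow by (simp add: flow_generated_by_def)

lemma flow_add: "\<phi> (s + t) x = \<phi> s (\<phi> t x)"
  using flow unfolding flow_generated_by_def by blast

lemma flow_deriv: "((\<lambda>t. \<phi> t x) has_vector_derivative f (\<phi> t x)) (at t)"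
  using flow unfolding flow_generated_by_def by blast

lemma continuous_flow: "continuous_on UNIV (\<lambda>(t, x). \<phi> t x)"
  using flow unfolding flow_generated_by_def by blast

lemma tendsto_flow:
  assumes "(u \<longlongrightarrow> t) F" "(v \<longlongrightarrow> x) F"
  shows "((\<lambda>i. \<phi> (u i) (v i)) \<longlongrightarrow> \<phi> t x) F"
proof -
  have "isCont (\<lambda>(t, x). \<phi> t x) (t, x)"
    using continuous_flow by (simp add: continuous_on_eq_continuous_at)
  from isCont_tendsto_compose[OF this tendsto_Pair[OF assms]] show ?thesis by simp
qed

lemma continuous_on_flow [continuous_intros]:
  assumes "continuous_on S u" "continuous_on S v"
  shows "continuous_on S (\<lambda>i. \<phi> (u i) (v i))"
  using assms unfolding continuous_on_def by (blast intro: tendsto_flow)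

lemma continuous_on_L [continuous_intros]:
  assumes "continuous_on S u" shows "continuous_on S (\<lambda>i. L (u i))"
  by (rule continuous_on_compose2[OF continuous_L assms]) simp

text \<open>Run the flow backwards from \<open>p\<close>, which is fixed. So no other trajectory
  arrives at \<open>p\<close> in finite time, and \<open>L'\<close> is strictly negative wherever
  such a trajectory exits.\<close>

lemma flow_eq_p: "\<phi> t x = p \<Longrightarrow> x = p"
  using flow_add[of "-t" t x] flow_p by simp

section \<open>Decrease of \<open>L\<close> and confinement near \<open>p\<close>\<close>

lemma L'_nonpos: "x \<in> B \<Longrightarrow> L' x \<le> 0"
proof (cases "x = p")
  case True
  have "((\<lambda>t. L (\<phi> t p)) has_real_derivative L' p) (at 0)"
    using deriv_L[of p 0] by simp
  then have "L' p = 0" using DERIV_unique[OF _ DERIV_const] by (simp add: flow_p)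
  with True show ?thesis by simp
next
  case False
  assume "x \<in> B"
  with L'_neg False show ?thesis by fastforce
qed

lemma L_decrease:
  assumes "s \<le> t" "\<And>u. u \<in> {s..t} \<Longrightarrow> L' (\<phi> u x) \<le> - c"
  shows "L (\<phi> t x) \<le> L (\<phi> s x) - c * (t - s)"
proof -
  \<comment> \<open>Adding \<open>c * t\<close> turns the bound on the rate into plain
    monotonicity.\<close>
  have "L (\<phi> t x) + c * t \<le> L (\<phi> s x) + c * s"
  proof (rule DERIV_nonpos_imp_nonincreasing[OF assms(1)])
    fix u assume "s \<le> u" "u \<le> t"
    moreover have "((\<lambda>t. L (\<phi> t x) + c * t) has_real_derivative L' (\<phi> u x) + c) (at u)"
      by (auto intro!: derivative_eq_intros deriv_L)
    ultimately show "\<exists>y. ((\<lambda>t. L (\<phi> t x) + c * t) has_real_derivative y) (at u) \<and> y \<le> 0"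
      using assms(2)[of u] by force
  qed
  then show ?thesis by (simp add: algebra_simps)
qed

text \<open>The part of \<open>B\<close> at distance at least \<delta> from \<open>p\<close> is
  compact, and \<open>L'\<close> is continuous and negative there, so its maximum is
  negative.\<close>

lemma decrease_rate:
  assumes "0 < \<delta>"
  obtains c where "0 < c" "\<And>z. z \<in> B \<Longrightarrow> \<delta> \<le> dist z p \<Longrightarrow> L' z \<le> - c"
proof -
  let ?K = "B \<inter> {z. \<delta> \<le> dist z p}"
  have K: "compact ?K"
    by (intro compact_Int_closed compact_B closed_Collect_le continuous_intros)
  show ?thesis
  proof (cases "?K = {}")
    case True
    then show ?thesis by (intro that[of 1]) auto
  next
    case False
    then obtain y where y: "y \<in> ?K" "\<And>z. z \<in> ?K \<Longrightarrow> L' z \<le> L' y"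
      using continuous_attains_sup[OF K _ continuous_on_subset[OF continuous_L']] by blast
    then have "L' y < 0" using L'_neg assms by force
    with y show ?thesis by (intro that[of "- L' y"]) auto
  qed
qed

lemma remains_mono: "remains x t \<Longrightarrow> 0 \<le> s \<Longrightarrow> s \<le> t \<Longrightarrow> remains x s"
  by (auto simp: remains_def)

lemma remains_shift:
  assumes "remains x t" "0 \<le> s" "s \<le> t"
  shows "remains (\<phi> s x) (t - s)"
  using assms by (auto simp: remains_def flow_add[symmetric])

text \<open>Crossing the annulus \<open>\<delta>/2 \<le> dist z p \<le> \<delta>\<close> takes a minimal time, because the speed
  is bounded, and hence costs a fixed amount of \<open>L\<close>, which is not available close to \<open>p\<close>.\<close>

lemma trapping:
  assumes "0 < \<delta>"
  obtains \<eta> where "0 < \<eta>"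
    "\<And>y t. dist y p < \<eta> \<Longrightarrow> remains y t \<Longrightarrow> dist (\<phi> t y) p < \<delta>"
proof -
  obtain c where c: "0 < c" "\<And>z. z \<in> B \<Longrightarrow> \<delta>/2 \<le> dist z p \<Longrightarrow> L' z \<le> - c"
    using decrease_rate[of "\<delta>/2"] assms by auto
  have "bounded (f ` B)"
    by (intro compact_imp_bounded compact_continuous_image compact_B
        continuous_on_subset[OF continuous_f]) simp
  then obtain M where M: "0 < M" "\<And>z. z \<in> B \<Longrightarrow> norm (f z) \<le> M"
    unfolding bounded_pos by auto
  \<comment> \<open>Moving a distance \<delta>/2 at speed at most \<open>M\<close> takes at least
    \<open>\<delta> / (2 * M)\<close>; at decrease rate \<open>c\<close> this costs
    \<open>e\<close>.\<close>
  define e where "e = c * (\<delta> / (2 * M))"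
  have "0 < e" using c M assms by (simp add: e_def)
  have "isCont L p" using continuous_L by (simp add: continuous_on_eq_continuous_at)
  then obtain r where r: "0 < r" "\<And>y. dist y p < r \<Longrightarrow> dist (L y) (L p) < e"
    using \<open>0 < e\<close> unfolding continuous_at_eps_delta by blast
  show ?thesis
  proof (rule that[of "min r (\<delta>/2)"])
    show "0 < min r (\<delta>/2)" using r assms by simp
    fix y t assume y: "dist y p < min r (\<delta>/2)" and rem: "remains y t"
    show "dist (\<phi> t y) p < \<delta>"
    proof (rule ccontr)
      assume far: "\<not> dist (\<phi> t y) p < \<delta>"
      \<comment> \<open>The maximum \<open>s\<close> of this set is the last visit to the inner
        ball; from then on the rate \<open>c\<close> is available up to time
        \<open>t\<close>.\<close>
      let ?I = "{0..t} \<inter> {u. dist (\<phi> u y) p \<le> \<delta>/2}"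
      have "compact ?I"
        by (intro compact_Int_closed closed_Collect_le continuous_intros) auto
      moreover have "0 \<in> ?I" using y rem by (auto simp: remains_def)
      ultimately obtain s where s: "s \<in> ?I" "\<And>u. u \<in> ?I \<Longrightarrow> u \<le> s"
        using compact_attains_sup[of ?I] by blast
      have "s \<le> t" using s by auto
      have out: "\<delta>/2 \<le> dist (\<phi> u y) p" if u: "u \<in> {s<..t}" for u
        using s(2)[of u] s(1) u by fastforce
      have inB: "\<phi> u y \<in> B" if "u \<in> {0..t}" for u
        using rem that by (auto simp: remains_def)
      \<comment> \<open>The intermediate value theorem gives a time after \<open>s\<close> at
        distance exactly \<delta>/2, and maximality identifies it with \<open>s\<close>. Thus the
        rate bound holds at the endpoint \<open>s\<close> as well.\<close>
      have at_s: "dist (\<phi> s y) p = \<delta>/2"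
      proof -
        have "\<exists>u\<ge>s. u \<le> t \<and> dist (\<phi> u y) p = \<delta>/2"
          using s(1) far assms by (intro IVT' continuous_intros) auto
        then obtain u where "s \<le> u" "u \<le> t" "dist (\<phi> u y) p = \<delta>/2" by blast
        moreover from this have "u \<in> ?I" using s(1) by simp
        then have "u \<le> s" by (rule s(2))
        ultimately show ?thesis by simp
      qed
      have "norm (\<phi> t y - \<phi> s y) \<le> M * norm (t - s)"
      proof (rule differentiable_bound[of "{s..t}" "\<lambda>u. \<phi> u y" "\<lambda>u h. h *\<^sub>R f (\<phi> u y)"])
        fix u assume "u \<in> {s..t}"
        then have "\<phi> u y \<in> B" using s(1) inB by auto
        then show "onorm (\<lambda>h. h *\<^sub>R f (\<phi> u y)) \<le> M"
          using M(2) by (simp add: onorm_scaleR_left onorm_id)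
        show "((\<lambda>u. \<phi> u y) has_derivative (\<lambda>h. h *\<^sub>R f (\<phi> u y))) (at u within {s..t})"
          using flow_deriv has_vector_derivative_at_within has_vector_derivative_def by blast
      qed (use \<open>s \<le> t\<close> in auto)
      moreover have "\<delta>/2 \<le> norm (\<phi> t y - \<phi> s y)"
        using far s(1) dist_triangle[of "\<phi> t y" p "\<phi> s y"] by (simp add: dist_norm)
      ultimately have "\<delta> / (2 * M) \<le> t - s"
        using M \<open>s \<le> t\<close> by (simp add: field_simps)
      then have "e \<le> c * (t - s)" using c(1) unfolding e_def by (intro mult_left_mono) auto
      moreover have "L (\<phi> t y) \<le> L (\<phi> s y) - c * (t - s)"
      proof (rule L_decrease[OF \<open>s \<le> t\<close>])
        fix u assume "u \<in> {s..t}"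
        show "L' (\<phi> u y) \<le> - c"
          using c(2)[of "\<phi> u y"] inB[of u] out[of u] s(1) at_s \<open>u \<in> {s..t}\<close>
          by (cases "u = s") auto
      qed
      \<comment> \<open>Before \<open>s\<close> only monotonicity is used, that is, rate 0.\<close>
      moreover have "L (\<phi> s y) \<le> L (\<phi> 0 y) - 0 * (s - 0)"
        by (rule L_decrease) (use s(1) inB L'_nonpos in auto)
      moreover have "L y < e" using r(2)[of y] y L_p by (simp add: dist_real_def)
      moreover have "0 \<le> L (\<phi> t y)" using inB[of t] L_nonneg \<open>s \<le> t\<close> s(1) by auto
      ultimately show False by simp
    qed
  qed
qed

section \<open>The exit time\<close>

lemma remains_0: "x \<in> B \<Longrightarrow> remains x 0"
  by (simp add: remains_def)

lemma exit_time_eq: "\<tau> x = Sup (ereal ` {t. remains x t})"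
  by (simp add: exit_time_def remains_def image_subset_iff)

lemma le_exit_time: "remains x t \<Longrightarrow> ereal t \<le> \<tau> x"
  by (auto simp: exit_time_eq intro: Sup_upper)

lemma exit_time_nonneg: "x \<in> B \<Longrightarrow> 0 \<le> \<tau> x"
  using le_exit_time[OF remains_0] by (simp add: zero_ereal_def)

text \<open>Times strictly below the supremum are dominated by an admissible one. The time
  \<open>t\<close> itself is reached as a limit from the left, because \<open>B\<close> is closed; a
  finite supremum is therefore attained.\<close>

lemma remains_before_exit:
  assumes "x \<in> B" "0 \<le> t" "ereal t \<le> \<tau> x"
  shows "remains x t"
proof -
  have less: "remains x s" if s: "0 \<le> s" "ereal s < \<tau> x" for s
  proof -
    obtain r where "remains x r" "s < r"
      using s(2) by (auto simp: exit_time_eq less_Sup_iff)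
    with s(1) remains_mono[of x r s] show ?thesis by simp
  qed
  have "\<phi> t x \<in> B"
  proof (cases "t = 0")
    case True
    with assms show ?thesis by simp
  next
    case False
    then have "\<forall>\<^sub>F s in at_left t. s \<in> {0<..<t}"
      using assms(2) by (intro eventually_at_leftI[of 0]) auto
    then have "\<forall>\<^sub>F s in at_left t. \<phi> s x \<in> B"
    proof eventually_elim
      case (elim s)
      then have "ereal s < \<tau> x" by (intro less_le_trans[OF _ assms(3)]) simp
      with elim less[of s] show ?case by (simp add: remains_def)
    qed
    moreover have "((\<lambda>s. \<phi> s x) \<longlongrightarrow> \<phi> t x) (at_left t)"
      by (intro tendsto_flow tendsto_intros)
    ultimately show ?thesis
      by (intro Lim_in_closed_set[OF compact_imp_closed[OF compact_B]]) auto
  qed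
  moreover have "\<phi> s x \<in> B" if "0 \<le> s" "s < t" for s
  proof -
    have "ereal s < \<tau> x" using that(2) by (intro less_le_trans[OF _ assms(3)]) simp
    with less that(1) show ?thesis by (simp add: remains_def)
  qed
  ultimately have "\<phi> s x \<in> B" if "0 \<le> s" "s \<le> t" for s
    using that by (cases "s = t") auto
  then show ?thesis using assms(2) by (simp add: remains_def)
qed

lemma in_B_before_exit:
  assumes "x \<in> B" "0 \<le> t" "ereal t \<le> \<tau> x"
  shows "\<phi> t x \<in> B"
  using remains_before_exit[OF assms] assms(2) by (auto simp: remains_def)

text \<open>The derivative of \<open>L\<close> along the trajectory is strictly negative at a zero
  of \<open>L\<close> other than \<open>p\<close>.\<close>

lemma leaves:
  assumes "x \<in> B" "x \<noteq> p" "L x = 0"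
  obtains \<epsilon> where "0 < \<epsilon>" "\<And>h. 0 < h \<Longrightarrow> h < \<epsilon> \<Longrightarrow> L (\<phi> h x) < 0"
proof -
  have "((\<lambda>t. L (\<phi> t x)) has_real_derivative L' x) (at 0)"
    using deriv_L[of x 0] by simp
  from has_real_derivative_neg_dec_right[OF this L'_neg[OF assms(1,2)]] that assms(3)
  show ?thesis by auto
qed

text \<open>At a zero of \<open>L\<close> the trajectory would at once enter \<open>L < 0\<close>
  and so be outside \<open>B\<close>, although the exit time is still ahead.\<close>

lemma L_pos_before_exit:
  assumes "x \<in> B" "x \<noteq> p" "0 \<le> t" "ereal t < \<tau> x"
  shows "0 < L (\<phi> t x)"
proof (rule ccontr)
  assume "\<not> 0 < L (\<phi> t x)"
  moreover have inB: "\<phi> t x \<in> B" using in_B_before_exit assms by simp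
  ultimately have "L (\<phi> t x) = 0" using L_nonneg by fastforce
  moreover have "\<phi> t x \<noteq> p" using flow_eq_p assms(2) by blast
  ultimately obtain \<epsilon> where \<epsilon>: "0 < \<epsilon>" "\<And>h. 0 < h \<Longrightarrow> h < \<epsilon> \<Longrightarrow> L (\<phi> h (\<phi> t x)) < 0"
    using leaves[OF inB] by blast
  obtain r where r: "t < r" "ereal r < \<tau> x" using ereal_dense2[OF assms(4)] by auto
  \<comment> \<open>Small enough both for \<open>L\<close> to be negative after time
    \<open>h\<close> and for \<open>h + t\<close> to lie before the exit time.\<close>
  define h where "h = min (r - t) (\<epsilon> / 2)"
  have h: "0 < h" "h < \<epsilon>" "h + t \<le> r" using r \<epsilon> by (auto simp: h_def)
  have "ereal (h + t) \<le> \<tau> x" using h(3) by (intro order_trans[OF _ less_imp_le[OF r(2)]]) simp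
  then have "0 \<le> L (\<phi> (h + t) x)"
    using in_B_before_exit assms h by (intro L_nonneg) auto
  with \<epsilon>(2)[OF h(1,2)] show False by (simp add: flow_add)
qed

text \<open>If \<open>L\<close> were positive at the exit point, \<open>entering\<close> would
  prolong the stay in \<open>B\<close> past the supremum.\<close>

lemma L_at_exit:
  assumes "x \<in> B" "\<tau> x = ereal r"
  shows "L (\<phi> r x) = 0"
proof (rule ccontr)
  assume nz: "L (\<phi> r x) \<noteq> 0"
  have "0 \<le> r" using exit_time_nonneg assms by fastforce
  then have rem: "remains x r" using remains_before_exit assms by simp
  then have inB: "\<phi> r x \<in> B" using \<open>0 \<le> r\<close> by (simp add: remains_def)
  with nz L_nonneg have "0 < L (\<phi> r x)" by fastforce
  with entering inB obtain \<epsilon> where \<epsilon>: "0 < \<epsilon>" "\<And>t. 0 < t \<Longrightarrow> t < \<epsilon> \<Longrightarrow> \<phi> t (\<phi> r x) \<in> B"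
    by (meson greaterThanLessThan_iff)
  have "\<phi> s x \<in> B" if "0 \<le> s" "s \<le> r + \<epsilon>/2" for s
  proof (cases "s \<le> r")
    case True
    with that rem show ?thesis by (simp add: remains_def)
  next
    case False
    with that \<epsilon> have "\<phi> (s - r) (\<phi> r x) \<in> B" by auto
    then show ?thesis by (simp flip: flow_add)
  qed
  then have "remains x (r + \<epsilon>/2)" using \<open>0 \<le> r\<close> \<epsilon>(1) by (simp add: remains_def)
  from le_exit_time[OF this] assms(2) \<epsilon>(1) show False by simp
qed

lemma exit_time_p [simp]: "\<tau> p = \<infinity>"
proof (rule ereal_top)
  fix t :: real
  have "remains p (max t 0)" using p_in_B by (simp add: remains_def flow_p)
  from le_exit_time[OF this] show "ereal t \<le> \<tau> p" by (rule order_trans[rotated]) simp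
qed

lemma exit_time_eq_0:
  assumes "x \<in> B" "x \<noteq> p" "L x = 0"
  shows "\<tau> x = 0"
proof (rule antisym[OF _ exit_time_nonneg[OF assms(1)]])
  have "\<not> ereal 0 < \<tau> x"
    using L_pos_before_exit[OF assms(1,2), of 0] assms(3) by auto
  then show "\<tau> x \<le> 0" by (simp add: zero_ereal_def not_less)
qed

text \<open>An earlier exit would happen at a zero of \<open>L\<close>. This bounds \<tau> from
  below by a condition that is stable under perturbing \<open>x\<close>.\<close>

lemma le_exit_time_if_L_pos:
  assumes "x \<in> B" "\<And>s. s \<in> {0..T} \<Longrightarrow> 0 < L (\<phi> s x)"
  shows "ereal T \<le> \<tau> x"
proof (rule ccontr)
  assume "\<not> ereal T \<le> \<tau> x"
  moreover have "0 \<le> \<tau> x" by (rule exit_time_nonneg[OF assms(1)])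
  ultimately obtain r where r: "\<tau> x = ereal r" "0 \<le> r" "r < T"
    by (cases "\<tau> x") auto
  with L_at_exit[OF assms(1) r(1)] assms(2)[of r] show False by simp
qed

section \<open>Trajectories that never leave\<close>

text \<open>Staying away from \<open>p\<close> forever would make \<open>L\<close> fall at a uniform
  rate and become negative inside \<open>B\<close>.\<close>

lemma reaches_p:
  assumes "x \<in> B" "\<tau> x = \<infinity>" "0 < \<eta>"
  obtains T where "0 \<le> T" "dist (\<phi> T x) p < \<eta>"
proof (rule ccontr)
  assume "\<not> thesis"
  with that have far: "\<eta> \<le> dist (\<phi> t x) p" if "0 \<le> t" for t using \<open>0 \<le> t\<close> by force
  have inB: "\<phi> t x \<in> B" if "0 \<le> t" for t using in_B_before_exit assms that by simp
  obtain c where c: "0 < c" "\<And>z. z \<in> B \<Longrightarrow> \<eta> \<le> dist z p \<Longrightarrow> L' z \<le> - c"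
    using decrease_rate[OF assms(3)] by blast
  \<comment> \<open>By this time the guaranteed loss \<open>c * t = L x + 1\<close> exceeds the
    initial value of \<open>L\<close>.\<close>
  define t where "t = (L x + 1) / c"
  have "0 \<le> t" using L_nonneg[OF assms(1)] c by (simp add: t_def)
  then have "L (\<phi> t x) \<le> L (\<phi> 0 x) - c * (t - 0)"
    using c(2) far inB by (intro L_decrease) auto
  moreover have "0 \<le> L (\<phi> t x)" using inB \<open>0 \<le> t\<close> L_nonneg by blast
  ultimately show False using c(1) by (simp add: t_def)
qed

text \<open>By \<open>reaches_p\<close> the trajectory comes within \<eta> of \<open>p\<close>; from
  then on \<open>trapping\<close> keeps it within \<delta>.\<close>

lemma converges_to_p:
  assumes "x \<in> B" "\<tau> x = \<infinity>"
  shows "((\<lambda>t. \<phi> t x) \<longlongrightarrow> p) at_top"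
proof (rule tendstoI)
  fix \<delta> :: real assume "0 < \<delta>"
  then obtain \<eta> where \<eta>: "0 < \<eta>" "\<And>y t. dist y p < \<eta> \<Longrightarrow> remains y t \<Longrightarrow> dist (\<phi> t y) p < \<delta>"
    using trapping by blast
  obtain T where T: "0 \<le> T" "dist (\<phi> T x) p < \<eta>" using reaches_p[OF assms \<eta>(1)] .
  have "dist (\<phi> t x) p < \<delta>" if "T \<le> t" for t
  proof -
    have "remains x t" using assms that T by (intro remains_before_exit) auto
    from \<eta>(2)[OF T(2) remains_shift[OF this T(1) that]] show ?thesis by (simp flip: flow_add)
  qed
  then show "\<forall>\<^sub>F t in at_top. dist (\<phi> t x) p < \<delta>"
    by (auto simp: eventually_at_top_linorder)
qed

text \<open>At \<open>p\<close> itself \<open>\<tau>\<close> is discontinuous in general: \<open>\<tau> p = \<infinity>\<close>, but \<open>\<tau> = 0\<close> at all other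
  zeros of \<open>L\<close> in \<open>B\<close>.\<close>

lemma tendsto_exit_time:
  assumes "x \<in> B" "x \<noteq> p"
  shows "(\<tau> \<longlongrightarrow> \<tau> x) (at x within B)"
proof (rule order_tendstoI)
  fix a assume a: "a < \<tau> x"
  show "\<forall>\<^sub>F y in at x within B. a < \<tau> y"
  proof (cases "a < 0")
    case True
    then show ?thesis
      using less_le_trans[OF True exit_time_nonneg] by (auto simp: eventually_at_filter)
  next
    case False
    then obtain r where r: "a < ereal r" "ereal r < \<tau> x" "0 < r"
      using ereal_dense2[OF a] by (metis ereal_less(2) leI le_less_trans)
    \<comment> \<open>Lower semicontinuity: positivity of \<open>L\<close> on the compact time
      interval \<open>{0..r}\<close> persists for nearby starting points by the tube lemma.\<close>
    let ?W = "{(y, s). 0 < L (\<phi> s y)}"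
    have "open ?W"
      unfolding case_prod_beta by (intro open_Collect_less continuous_intros)
    moreover have "0 < L (\<phi> s x)" if "s \<in> {0..r}" for s
    proof (rule L_pos_before_exit[OF assms])
      have "ereal s \<le> ereal r" using that by simp
      then show "ereal s < \<tau> x" using r(2) by (rule le_less_trans)
    qed (use that in simp)
    then have "{x} \<times> {0..r} \<subseteq> ?W" by auto
    ultimately obtain V where V: "x \<in> V" "open V" "V \<times> {0..r} \<subseteq> ?W"
      using Elementary_Topology.tube_lemma[of "{0..r}" ?W x] by auto
    then have "a < \<tau> y" if "y \<in> V" "y \<in> B" for y
      using le_exit_time_if_L_pos[of y r] that r(1) less_le_trans by blast
    with V show ?thesis by (auto simp: eventually_at_topological)
  qed
next
  fix a assume a: "\<tau> x < a"
  then obtain r where r: "\<tau> x = ereal r" "0 \<le> r"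
    using exit_time_nonneg[OF assms(1)] by (cases "\<tau> x") auto
  have "\<phi> r x \<in> B" using in_B_before_exit assms(1) r by simp
  moreover have "\<phi> r x \<noteq> p" using flow_eq_p assms(2) by blast
  moreover have "L (\<phi> r x) = 0" using L_at_exit assms(1) r(1) .
  ultimately obtain \<epsilon> where \<epsilon>: "0 < \<epsilon>" "\<And>h. 0 < h \<Longrightarrow> h < \<epsilon> \<Longrightarrow> L (\<phi> h (\<phi> r x)) < 0"
    using leaves by blast
  obtain q where q: "r < q" "ereal q < a" using ereal_dense2[of "ereal r" a] a r(1) by auto
  \<comment> \<open>Upper semicontinuity: at time \<open>h + r\<close>, just after the exit and not
    later than \<open>q\<close>, \<open>L\<close> is negative. This is an open condition on the
    starting point, and it forces an exit before that time.\<close>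
  define h where "h = min (q - r) (\<epsilon> / 2)"
  have h: "0 < h" "h < \<epsilon>" "h + r \<le> q" using q \<epsilon> by (auto simp: h_def)
  have "open {y. L (\<phi> (h + r) y) < 0}" by (intro open_Collect_less continuous_intros)
  moreover have "L (\<phi> (h + r) x) < 0" using \<epsilon>(2)[OF h(1,2)] by (simp add: flow_add)
  moreover have "\<tau> y < a" if "y \<in> B" "L (\<phi> (h + r) y) < 0" for y
  proof (rule ccontr)
    assume "\<not> \<tau> y < a"
    moreover have "ereal (h + r) \<le> ereal q" using h(3) by simp
    ultimately have "ereal (h + r) \<le> \<tau> y" using q(2) by (meson le_less_trans less_imp_le not_less order_trans)
    then have "\<phi> (h + r) y \<in> B" using in_B_before_exit that(1) h(1) r(2) by simp
    with L_nonneg that(2) show False by fastforce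
  qed
  ultimately show "\<forall>\<^sub>F y in at x within B. \<tau> y < a"
    unfolding eventually_at_topological by blast
qed

section \<open>The stopped flow and its joint continuity\<close>

text \<open>The time \<open>g\<close> is extended real, so that one family contains the identity
  (\<open>g = 0\<close>) and the exit map (\<open>g = \<infinity>\<close>). The value
  \<open>p\<close> is the limit of the trajectory when neither \<open>g\<close> nor the exit time
  stops it.\<close>

definition stopped :: "'a \<Rightarrow> ereal \<Rightarrow> 'a" where
  "stopped x g = (if min g (\<tau> x) = \<infinity> then p else \<phi> (real_of_ereal (min g (\<tau> x))) x)"

lemma stopped_in_B:
  assumes "x \<in> B" "0 \<le> g"
  shows "stopped x g \<in> B"
proof (cases "min g (\<tau> x) = \<infinity>")
  case False
  have "0 \<le> min g (\<tau> x)" using assms exit_time_nonneg by simp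
  with False obtain r where r: "min g (\<tau> x) = ereal r" "0 \<le> r"
    by (cases "min g (\<tau> x)") auto
  then have "ereal r \<le> \<tau> x" by (metis min.cobounded2)
  with r assms(1) in_B_before_exit show ?thesis by (simp add: stopped_def)
qed (simp add: stopped_def p_in_B)

lemma L_stopped:
  assumes "x \<in> B"
  shows "L (stopped x \<infinity>) = 0"
  using exit_time_nonneg[OF assms] L_at_exit[OF assms]
  by (cases "\<tau> x") (auto simp: stopped_def L_p)

lemma stopped_0: "x \<in> B \<Longrightarrow> stopped x 0 = x"
  using exit_time_nonneg[of x] by (simp add: stopped_def min_def)

text \<open>Zeros of \<open>L\<close> in \<open>B\<close> other than \<open>p\<close> have exit time
  0, and \<open>p\<close> is fixed by the flow.\<close>

lemma stopped_zero_set: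
  assumes "x \<in> B" "L x = 0" "0 \<le> g"
  shows "stopped x g = x"
  using exit_time_eq_0[OF assms(1) _ assms(2)] assms(3)
  by (cases "x = p") (auto simp: stopped_def flow_p min_def)

lemma exit_map_eq:
  assumes "x \<in> B"
  shows "exit_map \<phi> B x = stopped x \<infinity>"
  using converges_to_p[OF assms] by (simp add: exit_map_def stopped_def tendsto_Lim)

text \<open>In both cases there is a time \<open>T\<close> at which the trajectories of the nearby
  \<open>u i\<close> are close to \<open>p\<close> and not yet stopped. From then on
  \<open>trapping\<close> controls them however late they stop, so no convergence of the stopping
  times is required when \<open>x = p\<close>.\<close>

lemma tendsto_stopped_p:
  assumes x: "x \<in> B" and uB: "\<forall>\<^sub>F i in F. u i \<in> B" and u: "(u \<longlongrightarrow> x) F"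
    and w0: "\<forall>\<^sub>F i in F. 0 \<le> w i"
    and cases: "x = p \<or> \<tau> x = \<infinity> \<and> ((\<lambda>i. \<tau> (u i)) \<longlongrightarrow> \<infinity>) F \<and> (w \<longlongrightarrow> \<infinity>) F"
  shows "((\<lambda>i. stopped (u i) (w i)) \<longlongrightarrow> p) F"
proof (rule tendstoI)
  fix \<delta> :: real assume "0 < \<delta>"
  then obtain \<eta> where \<eta>: "0 < \<eta>" "\<And>y t. dist y p < \<eta> \<Longrightarrow> remains y t \<Longrightarrow> dist (\<phi> t y) p < \<delta>"
    using trapping by blast
  \<comment> \<open>For \<open>x = p\<close> take \<open>T = 0\<close>; otherwise \<open>T\<close>
    comes from \<open>reaches_p\<close>, and divergence of both times to infinity puts them
    eventually above \<open>T\<close>.\<close>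
  have "\<exists>T\<ge>0. dist (\<phi> T x) p < \<eta> \<and>
    (\<forall>\<^sub>F i in F. ereal T \<le> \<tau> (u i)) \<and> (\<forall>\<^sub>F i in F. ereal T \<le> w i)"
  proof (cases "x = p")
    case True
    have "\<forall>\<^sub>F i in F. 0 \<le> \<tau> (u i)"
      using uB by eventually_elim (rule exit_time_nonneg)
    with w0 True \<eta>(1) show ?thesis
      by (intro exI[of _ 0]) (auto simp flip: zero_ereal_def)
  next
    case False
    with cases have lim: "\<tau> x = \<infinity>" "((\<lambda>i. \<tau> (u i)) \<longlongrightarrow> \<infinity>) F" "(w \<longlongrightarrow> \<infinity>) F" by auto
    obtain T where T: "0 \<le> T" "dist (\<phi> T x) p < \<eta>" using reaches_p[OF x lim(1) \<eta>(1)] .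
    have "\<forall>\<^sub>F i in F. ereal T \<le> v i" if "(v \<longlongrightarrow> \<infinity>) F" for v
      using order_tendstoD(1)[OF that, of "ereal T"] by (auto elim: eventually_mono)
    with T lim show ?thesis by blast
  qed
  then obtain T where T: "0 \<le> T" "dist (\<phi> T x) p < \<eta>"
    and \<tau>: "\<forall>\<^sub>F i in F. ereal T \<le> \<tau> (u i)" and w: "\<forall>\<^sub>F i in F. ereal T \<le> w i"
    by blast
  have "((\<lambda>i. dist (\<phi> T (u i)) p) \<longlongrightarrow> dist (\<phi> T x) p) F"
    by (intro tendsto_intros tendsto_flow u)
  then have "\<forall>\<^sub>F i in F. dist (\<phi> T (u i)) p < \<eta>"
    using T(2) by (rule order_tendstoD(2))
  then show "\<forall>\<^sub>F i in F. dist (stopped (u i) (w i)) p < \<delta>"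
    using \<tau> w uB
  proof eventually_elim
    case (elim i)
    then have ge: "ereal T \<le> min (w i) (\<tau> (u i))" by simp
    show ?case
    proof (cases "min (w i) (\<tau> (u i)) = \<infinity>")
      case True
      then show ?thesis using \<open>0 < \<delta>\<close> by (simp add: stopped_def)
    next
      case False
      with ge obtain r where r: "min (w i) (\<tau> (u i)) = ereal r" "T \<le> r"
        by (cases "min (w i) (\<tau> (u i))") auto
      then have "ereal r \<le> \<tau> (u i)" by (metis min.cobounded2)
      then have "remains (u i) r"
        using elim T(1) r(2) by (intro remains_before_exit) auto
      from \<eta>(2)[OF elim(1) remains_shift[OF this T(1) r(2)]]
      have "dist (\<phi> r (u i)) p < \<delta>" by (simp flip: flow_add)
      with r(1) show ?thesis by (simp add: stopped_def)
    qed
  qed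
qed

text \<open>Away from \<open>p\<close> the exit time is continuous, hence so is the stopping time. A
  finite limit of the stopping time reduces the claim to continuity of the flow; the point
  \<open>p\<close> and an infinite limit are covered by \<open>tendsto_stopped_p\<close>.\<close>

lemma tendsto_stopped:
  assumes x: "x \<in> B" and g: "0 \<le> g" and uB: "\<forall>\<^sub>F i in F. u i \<in> B" and u: "(u \<longlongrightarrow> x) F"
    and w0: "\<forall>\<^sub>F i in F. 0 \<le> w i" and w: "(w \<longlongrightarrow> g) F"
  shows "((\<lambda>i. stopped (u i) (w i)) \<longlongrightarrow> stopped x g) F"
proof (cases "x = p")
  case True
  have "((\<lambda>i. stopped (u i) (w i)) \<longlongrightarrow> p) F"
    using tendsto_stopped_p[OF x uB u w0] True by blast
  with True p_in_B L_p g show ?thesis by (simp add: stopped_zero_set)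
next
  case False
  have "continuous (at x within B) \<tau>"
    using tendsto_exit_time[OF x False] by (simp add: continuous_within)
  then have \<tau>: "((\<lambda>i. \<tau> (u i)) \<longlongrightarrow> \<tau> x) F"
    using uB u by (rule continuous_within_tendsto_compose)
  show ?thesis
  proof (cases "min g (\<tau> x) = \<infinity>")
    case True
    then have "g = \<infinity>" "\<tau> x = \<infinity>" by (auto simp: min_def split: if_splits)
    then have "((\<lambda>i. stopped (u i) (w i)) \<longlongrightarrow> p) F"
      using tendsto_stopped_p[OF x uB u w0] \<tau> w by simp
    with True show ?thesis by (simp add: stopped_def)
  next
    case False
    let ?m = "\<lambda>i. min (w i) (\<tau> (u i))"
    have lim: "(?m \<longlongrightarrow> min g (\<tau> x)) F" by (intro tendsto_min w \<tau>)
    have "0 \<le> min g (\<tau> x)" using g exit_time_nonneg[OF x] by simp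
    with False obtain r where r: "min g (\<tau> x) = ereal r" by (cases "min g (\<tau> x)") auto
    have "((\<lambda>i. \<phi> (real_of_ereal (?m i)) (u i)) \<longlongrightarrow> \<phi> r x) F"
      using lim r by (intro tendsto_flow u lim_real_of_ereal) simp
    \<comment> \<open>Since the limit is finite, \<open>stopped\<close> eventually takes its flow
      branch.\<close>
    moreover have "\<forall>\<^sub>F i in F. ?m i < \<infinity>"
      using lim by (rule order_tendstoD(2)) (simp add: r)
    then have "\<forall>\<^sub>F i in F. \<phi> (real_of_ereal (?m i)) (u i) = stopped (u i) (w i)"
      by eventually_elim (simp add: stopped_def)
    ultimately show ?thesis using r by (auto simp: stopped_def intro: Lim_transform_eventually)
  qed
qed

lemma continuous_on_stopped:
  assumes "continuous_on S u" "u \<in> S \<rightarrow> B" "continuous_on S w" "w \<in> S \<rightarrow> {0..}"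
  shows "continuous_on S (\<lambda>i. stopped (u i) (w i))"
  unfolding continuous_on_def
proof
  fix i assume i: "i \<in> S"
  have S: "\<forall>\<^sub>F j in at i within S. j \<in> S" by (simp add: eventually_at_filter)
  show "((\<lambda>i. stopped (u i) (w i)) \<longlongrightarrow> stopped (u i) (w i)) (at i within S)"
  proof (rule tendsto_stopped)
    show "\<forall>\<^sub>F j in at i within S. u j \<in> B" "\<forall>\<^sub>F j in at i within S. 0 \<le> w j"
      using S assms(2,4) by (auto elim!: eventually_mono)
  qed (use i assms in \<open>auto simp: continuous_on_def\<close>)
qed

end

section \<open>Compactified time and the deformation\<close>

lemma continuous_on_compactified_time:
  "continuous_on {0..1} (\<lambda>s. if s = 1 then \<infinity> else ereal (s / (1 - s)))" (is "continuous_on _ ?G")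
  unfolding continuous_on_def
proof
  fix s :: real assume s: "s \<in> {0..1}"
  let ?F = "at s within {0..1}"
  show "(?G \<longlongrightarrow> ?G s) ?F"
  proof (cases "s = 1")
    case True
    have "\<forall>\<^sub>F u in ?F. ereal r < ?G u" for r
    proof -
      \<comment> \<open>The threshold is the preimage of \<open>\<bar>r\<bar>\<close> under
        \<open>s / (1 - s)\<close>; the absolute value keeps the denominator positive for every
        \<open>r\<close>.\<close>
      have "\<bar>r\<bar> / (1 + \<bar>r\<bar>) < s" using True by simp
      then have "\<forall>\<^sub>F u in ?F. \<bar>r\<bar> / (1 + \<bar>r\<bar>) < u"
        by (rule order_tendstoD(1)[OF tendsto_ident_at])
      moreover have "\<forall>\<^sub>F u in ?F. u \<in> {0..1}" by (simp add: eventually_at_filter)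
      ultimately show ?thesis
      proof eventually_elim
        case (elim u)
        show ?case
        proof (cases "u = 1")
          case False
          have "\<bar>r\<bar> < u * (1 + \<bar>r\<bar>)" using elim(1) by (simp add: divide_less_eq)
          then have "\<bar>r\<bar> * (1 - u) < u" by (simp add: algebra_simps)
          then have "\<bar>r\<bar> < u / (1 - u)" using elim(2) False by (simp add: less_divide_eq)
          with False show ?thesis by simp
        qed simp
      qed
    qed
    with True show ?thesis by (simp add: tendsto_PInfty)
  next
    case False
    with s have "s < 1" by simp
    have "((\<lambda>u. ereal (u / (1 - u))) \<longlongrightarrow> ereal (s / (1 - s))) ?F"
      using \<open>s < 1\<close> by (intro tendsto_intros) auto
    moreover have "\<forall>\<^sub>F u in ?F. u < 1"
      using \<open>s < 1\<close> by (rule order_tendstoD(2)[OF tendsto_ident_at])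
    then have "\<forall>\<^sub>F u in ?F. ereal (u / (1 - u)) = ?G u" by eventually_elim simp
    ultimately show ?thesis using False by (auto intro: Lim_transform_eventually)
  qed
qed

context lyapunov_exit
begin

lemma exit_map_zero_set: "exit_map \<phi> B \<in> B \<rightarrow> {x \<in> B. L x = 0}"
  by (simp add: exit_map_eq stopped_in_B L_stopped)

lemma continuous_on_exit_map: "continuous_on B (exit_map \<phi> B)"
proof -
  have "continuous_on B (\<lambda>x. stopped x \<infinity>)"
    by (intro continuous_on_stopped continuous_intros) auto
  then show ?thesis by (simp add: exit_map_eq cong: continuous_on_cong)
qed

text \<open>The homotopy is the flow stopped at the rescaled time \<open>G s\<close>: the identity
  at \<open>G 0 = 0\<close>, the exit map at \<open>G 1 = \<infinity>\<close>, and stationary on the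
  zero set throughout.\<close>

lemma strong_deformation_retract_zero_set: "strong_deformation_retract {x \<in> B. L x = 0} B"
proof -
  define G where "G = (\<lambda>s::real. if s = 1 then \<infinity> else ereal (s / (1 - s)))"
  have G: "0 \<le> G s" if "s \<in> {0..1}" for s using that by (simp add: G_def)
  have "continuous_on (B \<times> {0..1}) (\<lambda>z. stopped (fst z) (G (snd z)))"
  proof (rule continuous_on_stopped)
    show "continuous_on (B \<times> {0..1}) (\<lambda>z. G (snd z))"
      by (rule continuous_on_compose2[OF continuous_on_compactified_time[folded G_def]])
        (auto intro: continuous_intros)
  qed (use G in \<open>auto intro: continuous_intros\<close>)
  moreover have "G 0 = 0" "G 1 = \<infinity>" by (auto simp: G_def zero_ereal_def)
  ultimately show ?thesis
    unfolding strong_deformation_retract_def using compact_B G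
    by (intro conjI exI[of _ "\<lambda>z. stopped (fst z) (G (snd z))"])
      (auto simp: stopped_in_B stopped_0 stopped_zero_set L_stopped)
qed

end

section \<open>The quadratic Lyapunov function on \<open>D\<^sub>L\<close>\<close>

theorem theorem3p3:
  fixes f :: "real^'n \<Rightarrow> real^'n"
    and \<phi> :: "real \<Rightarrow> real^'n \<Rightarrow> real^'n"
    and D\<^sub>L B\<^sub>s b\<^sub>s :: "(real^'n) set"
    and L :: "real^'n \<Rightarrow> real"
    and Y :: "real^'n^'n"
    and xstar :: "real^'n"
    and \<S> :: "(real^'n) set set"
  assumes "smooth_map f"
    and "flow_generated_by f \<phi>"
    and "compact D\<^sub>L" and "starlike D\<^sub>L"
    and "Lyapunov_domain f \<phi> L D\<^sub>L"
    and "xstar \<in> D\<^sub>L" and "hyperbolic_equilibrium f xstar"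
    and "\<forall>x\<in>D\<^sub>L. equilibrium f x \<longrightarrow> x = xstar"
    and "transpose Y = Y"
    and "L = (\<lambda>x. (x - xstar) \<bullet> (Y *v (x - xstar)))"
    and "B\<^sub>s = D\<^sub>L \<inter> L -` {0..}"
    and "b\<^sub>s = D\<^sub>L \<inter> L -` {0}"
    and "frontier B\<^sub>s = b\<^sub>s \<union> \<Union>\<S>"
    and "\<forall>S\<in>\<S>. hypersurface S \<and> immediate_entrance \<phi> (D\<^sub>L \<inter> L -` {0<..}) S"
  shows "(\<forall>x\<in>B\<^sub>s. exit_time \<phi> B\<^sub>s x = \<infinity> \<longrightarrow> (\<exists>l. ((\<lambda>t. \<phi> t x) \<longlongrightarrow> l) at_top)) \<and>
         exit_map \<phi> B\<^sub>s \<in> B\<^sub>s \<rightarrow> b\<^sub>s \<and>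
         continuous_on B\<^sub>s (exit_map \<phi> B\<^sub>s) \<and>
         strong_deformation_retract b\<^sub>s B\<^sub>s"
proof -
  have f_cont: "continuous_on UNIV f"
  proof -
    have "times_differentiable (Suc 0) f" using assms(1) by (simp only: smooth_map_def)
    then show ?thesis
      by (auto intro: continuous_at_imp_continuous_on differentiable_imp_continuous_within)
  qed
  have flow_D: "\<phi> 0 x = x" "\<phi> (s + t) x = \<phi> s (\<phi> t x)"
    "((\<lambda>t. \<phi> t x) has_vector_derivative f (\<phi> t x)) (at t)" for s t x
    using assms(2) unfolding flow_generated_by_def by blast+
  \<comment> \<open>The derivative of the quadratic form along \<open>f\<close>, by the product
    rule.\<close>
  define L' where "L' x = (x - xstar) \<bullet> (Y *v f x) + f x \<bullet> (Y *v (x - xstar))" for x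
  have Y: "bounded_linear ((*v) Y)" by (rule matrix_vector_mul_bounded_linear)
  have L_deriv: "((\<lambda>t. L (\<phi> t x)) has_real_derivative L' (\<phi> t x)) (at t)" for x t
  proof -
    have d: "((\<lambda>t. \<phi> t x - xstar) has_vector_derivative f (\<phi> t x)) (at t)"
      using has_vector_derivative_diff[OF flow_D(3) has_vector_derivative_const] by simp
    then have "((\<lambda>t. Y *v (\<phi> t x - xstar)) has_vector_derivative Y *v f (\<phi> t x)) (at t)"
      by (rule bounded_linear.has_vector_derivative[OF Y])
    from bounded_bilinear.has_vector_derivative[OF bounded_bilinear_inner d this]
    show ?thesis
      by (simp add: assms(10) L'_def has_real_derivative_iff_has_vector_derivative)
  qed
  have eq: "f xstar = 0" using assms(7) by (simp add: hyperbolic_equilibrium_def equilibrium_def)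
  \<comment> \<open>The derivative in the Lyapunov condition is \<open>L' x\<close> by uniqueness of
    derivatives, and the equilibrium it provides must be \<open>xstar\<close>; evaluating at time 0
    gives \<open>x = xstar\<close>.\<close>
  have lyap: "L' x \<le> 0 \<and> (L' x = 0 \<longrightarrow> x = xstar \<and> (\<forall>t. \<phi> t x = xstar))"
    if x: "x \<in> D\<^sub>L" for x
  proof -
    obtain d where d: "((\<lambda>t. L (\<phi> t x)) has_real_derivative d) (at 0)" "d \<le> 0"
      "d = 0 \<Longrightarrow> \<exists>q\<in>D\<^sub>L. equilibrium f q \<and> (\<forall>t. \<phi> t x = q)"
      using bspec[OF assms(5)[unfolded Lyapunov_domain_def] x] by auto
    have "d = L' x" using DERIV_unique[OF d(1) L_deriv] by (simp add: flow_D(1))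
    moreover have "x = xstar \<and> (\<forall>t. \<phi> t x = xstar)" if "d = 0"
    proof -
      obtain q where q: "q \<in> D\<^sub>L" "equilibrium f q" "\<forall>t. \<phi> t x = q" using d(3)[OF \<open>d = 0\<close>] by blast
      then have "q = xstar" using assms(8) by blast
      with q(3) flow_D(1)[of x] show ?thesis by simp
    qed
    ultimately show ?thesis using d(2) by blast
  qed
  have bs: "b\<^sub>s = {x \<in> B\<^sub>s. L x = 0}" using assms(11,12) by auto
  have L_cont: "continuous_on UNIV L"
    unfolding assms(10) by (intro continuous_intros bounded_linear.continuous_on[OF Y])
  have closed_Bs: "compact B\<^sub>s"
    unfolding assms(11)
    by (intro compact_Int_closed assms(3) closed_vimage[OF _ L_cont]) simp
  interpret lyapunov_exit f \<phi> L L' B\<^sub>s xstar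
  proof
    show "continuous_on UNIV L'"
      unfolding L'_def by (intro continuous_intros bounded_linear.continuous_on[OF Y] f_cont)
    \<comment> \<open>Since \<open>f xstar = 0\<close>, also \<open>L' xstar = 0\<close>, and the
      equality case of the Lyapunov condition makes the trajectory constant.\<close>
    show "\<phi> t xstar = xstar" for t
      using lyap[OF assms(6)] eq by (simp add: L'_def)
    show "L xstar = 0" "xstar \<in> B\<^sub>s" by (simp_all add: assms(6,10,11))
    show "L' x < 0" if "x \<in> B\<^sub>s" "x \<noteq> xstar" for x
      using lyap[of x] that assms(11) by fastforce
    \<comment> \<open>A frontier point with \<open>L x > 0\<close> is not in
      \<open>b\<^sub>s\<close>, so it lies on an entrance hypersurface. At an interior point
      continuity of the trajectory suffices.\<close>
    show "\<exists>\<epsilon>>0. \<forall>t\<in>{0<..<\<epsilon>}. \<phi> t x \<in> B\<^sub>s" if x: "x \<in> B\<^sub>s" "0 < L x" for x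
    proof (cases "x \<in> frontier B\<^sub>s")
      case True
      with assms(13) bs x obtain S where "S \<in> \<S>" "x \<in> S" by auto
      with assms(14) obtain \<epsilon> where
        "0 < \<epsilon>" "(\<lambda>t. \<phi> t x) ` {0<..<\<epsilon>} \<subseteq> interior (D\<^sub>L \<inter> L -` {0<..})"
        unfolding immediate_entrance_def by blast
      moreover have "interior (D\<^sub>L \<inter> L -` {0<..}) \<subseteq> B\<^sub>s"
        using interior_subset assms(11) by force
      ultimately show ?thesis by blast
    next
      case False
      then have "x \<in> interior B\<^sub>s"
        using x(1) closure_subset by (auto simp: frontier_def)
      moreover have "((\<lambda>t. \<phi> t x) \<longlongrightarrow> x) (at_right 0)"
        using has_vector_derivative_continuous[OF has_vector_derivative_at_within[OF
            flow_D(3)[where t = 0 and x = x], of "{0<..}"]]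
        by (simp add: continuous_within flow_D(1))
      ultimately have "\<forall>\<^sub>F t in at_right 0. \<phi> t x \<in> interior B\<^sub>s"
        by (intro topological_tendstoD) auto
      then show ?thesis
        using interior_subset unfolding eventually_at_right_field by fastforce
    qed
  qed (use assms(2,11) f_cont L_cont L_deriv closed_Bs in auto)
  \<comment> \<open>By \<open>converges_to_p\<close>, the \<open>Lim\<close> in
    \<open>exit_map\<close> is a genuine limit whenever the exit time is infinite.\<close>
  show ?thesis
    using converges_to_p exit_map_zero_set continuous_on_exit_map
      strong_deformation_retract_zero_set unfolding bs by blast
qed

end
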